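(* Let $g\ge 1$, let $p_1,\dots,p_g$ be distinct odd primes, $n=p_1\cdots p_g$, $q$ a prime power with $\gcd(n,q)=1$, $N'=\mathrm{ord}_n(q)$, and $\theta$ a primitive $n$-th root of unity in $\mathbb{F}_{q^{N'}}$. Consider the QR codes of length $n$ defined in the context. Then: (1) the number of QR codes of length $n$ is $\prod_{r=0}^{g-1}\bigl(2(2^{g-r}-1)\bigr)^{\binom{g}{r}}$; (2) there exists an LCD QR code of length $n$ if and only if $p_i\equiv 1\pmod 4$ for every $i=1,\dots,g$; (3) there exists a self-orthogonal QR code of length $n$ if and only if $p_i\equiv 3\pmod 4$ for every $i=1,\dots,g$.
   Context: For $0\le r\le g-1$, $A_r$ is the set of all products of $r$ distinct primes among $p_1,\dots,p_g$ ($A_0=\{1\}$). For $d\in A_r$: $M_d=\{j:1\le j\le n-1,\gcd(j,n)=d\}$, $M^*_d=\{Q: Q\mid n/d,\ Q>1\}$, and for $Q\in M^*_d$, $\epsilon\in\{\pm1\}$: $M^\epsilon_{d,Q}=\{j\in M_d:(\tfrac{j}{Q})=\epsilon\}$ (Jacobi symbol), $F^\epsilon_{d,Q}(x)=\prod_{t\in M^\epsilon_{d,Q}}(x-\theta^t)$. A QR code of length $n$ is the cyclic code of length $n$ (an ideal of $K[x]/(x^n-1)$ with $K=\mathbb{F}_{q^{N'}}$, or $K=\mathbb{F}_q$ when the generator has coefficients in $\mathbb{F}_q$) generated by $g(x)=\prod_{r=0}^{g-1}\prod_{d\in A_r}F^{\epsilon_d}_{d,Q_d}(x)$, for a choice of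 $Q_d\in M^*_d$ and $\epsilon_d\in\{1,-1\}$ for each $d\in\bigcup_r A_r$. A linear code $\mathcal{C}$ is LCD if $\mathcal{C}\cap\mathcal{C}^\perp=\{0\}$, and (in this paper's terminology) self-orthogonal if $\mathcal{C}\cap\mathcal{C}^\perp=\mathcal{C}^\perp$, i.e. $\mathcal{C}^\perp\subseteq\mathcal{C}$, where $\perp$ is the dual for the standard inner product. *)

theory Defs
  imports "HOL-Library.Cardinality" "HOL-Number_Theory.Number_Theory"
    "HOL-Computational_Algebra.Computational_Algebra"
begin

definition Jacobi :: "int \<Rightarrow> nat \<Rightarrow> int" where
  "Jacobi a Q = (\<Prod>p\<in>#prime_factorization Q. Legendre a (int p))"

definition prim_root_unity :: "nat \<Rightarrow> 'a::field \<Rightarrow> bool" where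
  "prim_root_unity n \<theta> \<longleftrightarrow> \<theta> ^ n = 1 \<and> (\<forall>k. 0 < k \<and> k < n \<longrightarrow> \<theta> ^ k \<noteq> 1)"

text \<open>The copy of $F_q$ inside a finite extension field of it: the fixed points of
  the $q$-Frobenius.\<close>

definition Fq :: "nat \<Rightarrow> 'a::field set" where
  "Fq q = {x. x ^ q = x}"

definition polys_over :: "'a::field set \<Rightarrow> 'a poly set" where
  "polys_over K = {f. set (Polynomial.coeffs f) \<subseteq> K}"

text \<open>Words of length $n$ over $K$ (a subfield, given as a set) are represented by the
  polynomials over $K$ of degree less than $n$, i.e. by the canonical representatives of
  the classes in $K[x]/(x^n-1)$.\<close>

definition words :: "'a::field set \<Rightarrow> nat \<Rightarrow> 'a poly set" where
  "words K n = {c \<in> polys_over K. Polynomial.degree c < n}"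

definition cyclic_code :: "'a::field set \<Rightarrow> nat \<Rightarrow> 'a poly \<Rightarrow> 'a poly set" where
  "cyclic_code K n f = {(a * f) mod (Polynomial.monom 1 n - 1) | a. a \<in> polys_over K}"

definition dual_code :: "'a::field set \<Rightarrow> nat \<Rightarrow> 'a poly set \<Rightarrow> 'a poly set" where
  "dual_code K n C =
     {v \<in> words K n. \<forall>c\<in>C. (\<Sum>i<n. Polynomial.coeff v i * Polynomial.coeff c i) = 0}"

definition LCD_code :: "'a::field set \<Rightarrow> nat \<Rightarrow> 'a poly set \<Rightarrow> bool" where
  "LCD_code K n C \<longleftrightarrow> C \<inter> dual_code K n C = {0}"

text \<open>Here a code is called self-orthogonal if it contains its dual (elsewhere often called
  dual-containing).\<close>

definition self_orthogonal :: "'a::field set \<Rightarrow> nat \<Rightarrow> 'a poly set \<Rightarrow> bool" where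
  "self_orthogonal K n C \<longleftrightarrow> C \<inter> dual_code K n C = dual_code K n C"

definition A_set :: "(nat \<Rightarrow> nat) \<Rightarrow> nat \<Rightarrow> nat \<Rightarrow> nat set" where
  "A_set p g r = {\<Prod>i\<in>S. p i | S. S \<subseteq> {1..g} \<and> card S = r}"

definition M_set :: "nat \<Rightarrow> nat \<Rightarrow> nat set" where
  "M_set n d = {j. 1 \<le> j \<and> j \<le> n - 1 \<and> gcd j n = d}"

definition M_star :: "nat \<Rightarrow> nat \<Rightarrow> nat set" where
  "M_star n d = {Q. Q dvd n div d \<and> Q > 1}"

definition M_eps :: "nat \<Rightarrow> nat \<Rightarrow> nat \<Rightarrow> int \<Rightarrow> nat set" where
  "M_eps n d Q \<epsilon> = {j \<in> M_set n d. Jacobi (int j) Q = \<epsilon>}"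

definition F_poly :: "'a::field \<Rightarrow> nat \<Rightarrow> nat \<Rightarrow> nat \<Rightarrow> int \<Rightarrow> 'a poly" where
  "F_poly \<theta> n d Q \<epsilon> = (\<Prod>t\<in>M_eps n d Q \<epsilon>. [:- (\<theta> ^ t), 1:])"

definition QR_generator ::
    "'a::field \<Rightarrow> (nat \<Rightarrow> nat) \<Rightarrow> nat \<Rightarrow> nat \<Rightarrow> (nat \<Rightarrow> nat) \<Rightarrow> (nat \<Rightarrow> int) \<Rightarrow> 'a poly" where
  "QR_generator \<theta> p g n Q \<epsilon> = (\<Prod>r<g. \<Prod>d\<in>A_set p g r. F_poly \<theta> n d (Q d) (\<epsilon> d))"

definition QR_choice ::
    "(nat \<Rightarrow> nat) \<Rightarrow> nat \<Rightarrow> nat \<Rightarrow> (nat \<Rightarrow> nat) \<Rightarrow> (nat \<Rightarrow> int) \<Rightarrow> bool" where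
  "QR_choice p g n Q \<epsilon> \<longleftrightarrow>
     (\<forall>d \<in> (\<Union>r<g. A_set p g r). Q d \<in> M_star n d \<and> \<epsilon> d \<in> {1, -1})"

text \<open>A code with generator $f$ is taken over the whole field, or over $F_q$, the latter only
  if $f$ has coefficients in $F_q$. A base field rule says which of the two is used for each
  generator; so it may be constantly the whole field, or $F_q$ whenever possible.\<close>

definition base_field_rule :: "nat \<Rightarrow> ('a::field poly \<Rightarrow> 'a set) \<Rightarrow> bool" where
  "base_field_rule q \<kappa> \<longleftrightarrow> (\<forall>f. \<kappa> f = UNIV \<or> (\<kappa> f = Fq q \<and> f \<in> polys_over (Fq q)))"

text \<open>\<open>C\<close> is a QR code of length $n$ over the field \<open>K\<close>.\<close>

definition QR_code ::
    "('a::field poly \<Rightarrow> 'a set) \<Rightarrow> 'a \<Rightarrow> (nat \<Rightarrow> nat) \<Rightarrow> nat \<Rightarrow> nat \<Rightarrow> 'a set \<Rightarrow> 'a poly set \<Rightarrow> bool"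
  where
  "QR_code \<kappa> \<theta> p g n K C \<longleftrightarrow>
     (\<exists>Q \<epsilon>. QR_choice p g n Q \<epsilon> \<and> K = \<kappa> (QR_generator \<theta> p g n Q \<epsilon>) \<and>
            C = cyclic_code K n (QR_generator \<theta> p g n Q \<epsilon>))"

end

theory Submission
  imports Defs
begin

text \<open>
  Let $Z$ be the set of roots of the generator $f$. By Fourier inversion on the $n$-th roots of
  unity, a word $v$ lies in the dual of the code iff $v(x^{-1}) = 0$ for every root of unity
  $x \notin Z$; examples are the multiples of the reciprocal of $(x^n - 1) / f$, whose roots are
  exactly these $x^{-1}$. Hence the code is LCD iff $Z$ is closed under inversion, and it contains
  its dual iff $Z$ is disjoint from its set of inverses. On the part of $Z$ belonging to $d$,
  inversion multiplies the Jacobi symbol by $(\frac{-1}{Q_d})$, so the two conditions say that this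
  sign is $1$ for all $d$, respectively $-1$ for all $d$. For $d = n / p_i$ the only choice is
  $Q_d = p_i$, while for the other $d$ any prime factor of $n / d$ can be taken.
  By the Chinese remainder theorem the Legendre symbols of $j$ at the primes dividing $n / d$ can be
  prescribed independently, so different choices of $(Q_d, \epsilon_d)$ give different sets $Z$,
  and $Z$ is recovered from the code as its set of common zeros.
\<close>

subsection \<open>Squarefree numbers\<close>

lemma prod_prime_factors_squarefree:
  fixes m :: "'a::factorial_semiring_multiplicative"
  assumes "squarefree m"
  shows "\<Prod>(prime_factors m) = normalize m"
proof -
  have "m \<noteq> 0" using assms by auto
  have "\<Prod>(prime_factors m) = (\<Prod>p\<in>prime_factors m. p ^ multiplicity p m)"
    using assms squarefree_factorial_semiring'[OF \<open>m \<noteq> 0\<close>] by (intro prod.cong) auto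
  also have "\<dots> = normalize m" by (rule prod_prime_factors[OF \<open>m \<noteq> 0\<close>])
  finally show ?thesis .
qed

lemma squarefree_nat_eqI:
  fixes a b :: nat
  assumes "squarefree a" "squarefree b" "prime_factors a = prime_factors b"
  shows "a = b"
  using assms prod_prime_factors_squarefree by (metis normalize_nat_def id_apply)

lemma squarefree_mult_imp_coprime:
  fixes a b :: "'a::algebraic_semidom"
  assumes "squarefree (a * b)"
  shows "coprime a b"
proof (rule coprimeI)
  fix c assume "c dvd a" "c dvd b"
  then have "c ^ 2 dvd a * b" by (simp add: mult_dvd_mono power2_eq_square)
  then show "is_unit c" using assms by (rule squarefreeD[rotated])
qed

lemma gcd_squarefree_eqI:
  fixes x d n :: nat
  assumes "squarefree n" "d dvd n" "\<And>p. p \<in> prime_factors n \<Longrightarrow> p dvd x \<longleftrightarrow> p dvd d"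
  shows "gcd x n = d"
proof (rule squarefree_nat_eqI)
  have "n \<noteq> 0" using assms(1) by (metis not_squarefree_0)
  moreover have "d \<noteq> 0" using assms(2) \<open>n \<noteq> 0\<close> by (metis dvd_0_left)
  ultimately show "prime_factors (gcd x n) = prime_factors d"
    using assms(2,3) by (auto simp: prime_factors_dvd)
qed (use assms(1,2) squarefree_mono in blast)+

lemma prime_factors_prod_primes:
  fixes f :: "'b \<Rightarrow> 'a::factorial_semiring"
  assumes "finite I" "\<And>i. i \<in> I \<Longrightarrow> prime (f i)"
  shows "prime_factors (\<Prod>i\<in>I. f i) = f ` I"
proof -
  have "prime_factors (\<Prod>i\<in>I. f i) = (\<Union>i\<in>I. prime_factors (f i))"
    using assms by (subst prime_factors_prod) (auto dest: assms(2))
  also have "\<dots> = f ` I" using assms(2) by (auto simp: prime_factorization_prime)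
  finally show ?thesis .
qed

lemma squarefree_prod_primes:
  fixes f :: "'b \<Rightarrow> 'a::factorial_semiring_gcd"
  assumes "inj_on f I" "\<And>i. i \<in> I \<Longrightarrow> prime (f i)"
  shows "squarefree (\<Prod>i\<in>I. f i)"
  using assms
  by (intro squarefree_prod_coprime) (auto intro: primes_coprime squarefree_prime dest: inj_onD)

lemma bij_betw_prod_Pow_divisors:
  fixes f :: "'b \<Rightarrow> nat"
  assumes "finite I" "inj_on f I" "\<And>i. i \<in> I \<Longrightarrow> prime (f i)"
  shows "bij_betw (\<lambda>S. \<Prod>i\<in>S. f i) (Pow I) {d. d dvd (\<Prod>i\<in>I. f i)}"
proof (rule bij_betw_imageI)
  have factors: "prime_factors (\<Prod>i\<in>S. f i) = f ` S" if "S \<subseteq> I" for S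
    using that assms finite_subset by (intro prime_factors_prod_primes) blast+
  show "inj_on (\<lambda>S. \<Prod>i\<in>S. f i) (Pow I)"
    using assms(2) factors by (metis (no_types, lifting) PowD inj_onI inj_on_image_eq_iff)
  show "(\<lambda>S. \<Prod>i\<in>S. f i) ` Pow I = {d. d dvd (\<Prod>i\<in>I. f i)}"
  proof (intro equalityI subsetI)
    fix d assume "d \<in> {d. d dvd (\<Prod>i\<in>I. f i)}"
    then have d_dvd: "d dvd (\<Prod>i\<in>I. f i)" by simp
    have sqfree: "squarefree (\<Prod>i\<in>S. f i)" if "S \<subseteq> I" for S
      using that assms by (intro squarefree_prod_primes) (auto intro: inj_on_subset)
    have "(\<Prod>i\<in>I. f i) \<noteq> 0" using sqfree[OF order.refl] by (metis not_squarefree_0)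
    then have "prime_factors d \<subseteq> f ` I"
      using dvd_prime_factors d_dvd factors[OF order.refl] by metis
    then obtain S where S_factors: "S \<subseteq> I" "prime_factors d = f ` S"
      by (auto simp: subset_image_iff)
    then have "d = (\<Prod>i\<in>S. f i)"
      using squarefree_nat_eqI[OF squarefree_mono[OF d_dvd] sqfree[OF S_factors(1)]]
        sqfree[OF order.refl] factors[OF S_factors(1)] by simp
    then show "d \<in> (\<lambda>S. \<Prod>i\<in>S. f i) ` Pow I" using S_factors(1) by blast
  qed (use assms(1) in \<open>auto intro: prod_dvd_prod_subset\<close>)
qed

lemma card_divisors_prod_primes:
  fixes f :: "'b \<Rightarrow> nat"
  assumes "finite I" "inj_on f I" "\<And>i. i \<in> I \<Longrightarrow> prime (f i)"
  shows "card {d. d dvd (\<Prod>i\<in>I. f i)} = 2 ^ card I"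
  using bij_betw_same_card[OF bij_betw_prod_Pow_divisors[OF assms]] assms(1)
  by (simp add: card_Pow)

subsection \<open>Legendre and Jacobi symbols\<close>

lemma odd_prime_gt_2: "prime p \<Longrightarrow> odd p \<Longrightarrow> p > 2" for p :: nat
  using prime_ge_2_nat[of p] by (cases "p = 2") auto

lemma Legendre_one:
  assumes "prime p"
  shows "Legendre 1 (int p) = 1"
proof -
  have "[1 ^ 2 = 1] (mod int p)" by simp
  then have "QuadRes (int p) 1" unfolding QuadRes_def by blast
  then show ?thesis using prime_gt_1_nat[OF assms] by (simp add: Legendre_def cong_def)
qed

lemma Legendre_cong:
  assumes "[a = b] (mod p)"
  shows "Legendre a p = Legendre b p"
proof -
  have "[a = 0] (mod p) \<longleftrightarrow> [b = 0] (mod p)" "QuadRes p a \<longleftrightarrow> QuadRes p b"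
    unfolding QuadRes_def using assms by (meson cong_sym cong_trans)+
  then show ?thesis by (simp add: Legendre_def)
qed

lemma Legendre_eqI:
  assumes "p > 2" "x \<in> {0, 1, -1}" "[Legendre a (int p) = x] (mod int p)"
  shows "Legendre a (int p) = x"
proof (rule ccontr)
  assume "Legendre a (int p) \<noteq> x"
  then have "int p \<le> \<bar>Legendre a (int p) - x\<bar>"
    using assms(3) dvd_imp_le_int[of "Legendre a (int p) - x" "int p"]
    by (simp add: cong_iff_dvd_diff)
  then show False using assms(1,2) by (auto simp: Legendre_def split: if_splits)
qed

lemma Legendre_mult:
  assumes "prime p" "p > 2"
  shows "Legendre (a * b) (int p) = Legendre a (int p) * Legendre b (int p)"
proof (rule Legendre_eqI[OF assms(2)])
  show "Legendre a (int p) * Legendre b (int p) \<in> {0, 1, -1}" by (simp add: Legendre_def)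
  have "[Legendre (a * b) (int p) = (a * b) ^ ((p - 1) div 2)] (mod int p)"
    by (rule euler_criterion[OF assms])
  also have "[(a * b) ^ ((p - 1) div 2) = Legendre a (int p) * Legendre b (int p)] (mod int p)"
    unfolding power_mult_distrib by (intro cong_mult cong_sym[OF euler_criterion[OF assms]])
  finally show "[Legendre (a * b) (int p) = Legendre a (int p) * Legendre b (int p)] (mod int p)" .
qed

lemma Legendre_minus_one:
  assumes "prime p" "odd p"
  shows "Legendre (- 1) (int p) = (if [p = 1] (mod 4) then 1 else - 1)"
proof (rule Legendre_eqI)
  have "p > 2" using assms by (rule odd_prime_gt_2)
  have "even ((p - 1) div 2) \<longleftrightarrow> [p = 1] (mod 4)" unfolding cong_def using assms(2) by presburger
  then show "[Legendre (- 1) (int p) = (if [p = 1] (mod 4) then 1 else - 1)] (mod int p)"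
    using euler_criterion[OF assms(1) \<open>p > 2\<close>, of "- 1"] by (auto split: if_splits)
qed (use odd_prime_gt_2 assms in auto)

lemma Legendre_minus_one_eq_iff:
  assumes "prime p" "odd p"
  shows "Legendre (- 1) (int p) = 1 \<longleftrightarrow> [p = 1] (mod 4)"
    and "Legendre (- 1) (int p) = - 1 \<longleftrightarrow> [p = 3] (mod 4)"
proof -
  have "p mod 4 = 1 \<or> p mod 4 = 3" using assms(2) by presburger
  then have "[p = 3] (mod 4) \<longleftrightarrow> \<not> [p = 1] (mod 4)" by (auto simp: cong_def)
  then show "Legendre (- 1) (int p) = 1 \<longleftrightarrow> [p = 1] (mod 4)"
    "Legendre (- 1) (int p) = - 1 \<longleftrightarrow> [p = 3] (mod 4)"
    by (auto simp: Legendre_minus_one[OF assms])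
qed

text \<open>A primitive root is a nonresidue: its order $p - 1$ does not divide $(p - 1) / 2$.\<close>

lemma ex_Legendre_eq_minus_one:
  assumes "prime p" "p > 2"
  shows "\<exists>u::nat. Legendre (int u) (int p) = - 1"
proof -
  obtain u where primroot: "residue_primroot p u" using prime_primitive_root_exists assms by force
  have "\<not> p - 1 dvd (p - 1) div 2" using assms(2) by (auto dest: dvd_imp_le)
  then have "\<not> [u ^ ((p - 1) div 2) = 1] (mod p)"
    using primroot assms(1) by (simp add: ord_divides' residue_primroot_def totient_prime)
  then have "\<not> [int u ^ ((p - 1) div 2) = 1] (mod int p)"
    by (metis cong_int_iff of_nat_1 of_nat_power)
  then have "Legendre (int u) (int p) \<noteq> 1"
    using euler_criterion[OF assms, of "int u"] cong_sym by metis
  moreover have "coprime p u" using primroot by (simp add: residue_primroot_def)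
  then have "\<not> p dvd u" using assms(1) coprime_common_divisor dvd_refl not_prime_unit by blast
  then have "\<not> [int u = 0] (mod int p)" by (simp add: cong_0_iff)
  ultimately have "Legendre (int u) (int p) = - 1" by (simp add: Legendre_def split: if_splits)
  then show ?thesis by blast
qed

lemma ex_prescribed_Legendre:
  assumes "finite P" "\<And>p. p \<in> P \<Longrightarrow> prime p \<and> p > 2" "\<And>p. p \<in> P \<Longrightarrow> s p \<in> {0, 1, -1}"
  shows "\<exists>x::nat. \<forall>p\<in>P. Legendre (int x) (int p) = s p"
proof -
  have "\<exists>u::nat. Legendre (int u) (int p) = s p" if in_P: "p \<in> P" for p
  proof -
    have "Legendre (int 0) (int p) = 0" by (simp add: Legendre_def)
    moreover have "Legendre (int 1) (int p) = 1" using Legendre_one assms(2)[OF in_P] by simp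
    moreover obtain u :: nat where "Legendre (int u) (int p) = - 1"
      using ex_Legendre_eq_minus_one assms(2)[OF in_P] by blast
    ultimately show ?thesis using assms(3)[OF in_P] by (metis empty_iff insert_iff)
  qed
  then obtain u :: "nat \<Rightarrow> nat" where symbol_u:
    "\<And>p. p \<in> P \<Longrightarrow> Legendre (int (u p)) (int p) = s p"
    by metis
  have "\<forall>p\<in>P. \<forall>p'\<in>P. p \<noteq> p' \<longrightarrow> coprime p p'"
    using assms(2) by (simp add: primes_coprime)
  then have "\<exists>x. \<forall>p\<in>P. [x = u p] (mod p)" by (rule chinese_remainder_nat[OF assms(1)])
  then obtain x where cong_u: "\<And>p. p \<in> P \<Longrightarrow> [x = u p] (mod p)" by blast
  have "Legendre (int x) (int p) = s p" if "p \<in> P" for p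
    using Legendre_cong[of "int x" "int (u p)" "int p"] cong_u[OF that] symbol_u[OF that]
    by (simp add: cong_int_iff)
  then show ?thesis by blast
qed

lemma Jacobi_prime: "prime p \<Longrightarrow> Jacobi a p = Legendre a (int p)"
  by (simp add: Jacobi_def prime_factorization_prime)

lemma Jacobi_squarefree:
  assumes "squarefree Q"
  shows "Jacobi a Q = (\<Prod>p\<in>prime_factors Q. Legendre a (int p))"
proof -
  have "Q \<noteq> 0" using assms by (metis not_squarefree_0)
  show ?thesis
    unfolding Jacobi_def image_prod_mset_multiplicity
    using assms squarefree_factorial_semiring'[OF \<open>Q \<noteq> 0\<close>]
    by (intro prod.cong) (auto simp: count_prime_factorization)
qed

lemma Jacobi_cong:
  assumes "[a = b] (mod int Q)"
  shows "Jacobi a Q = Jacobi b Q"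
proof -
  have "[a = b] (mod int p)" if "p \<in># prime_factorization Q" for p
    using assms cong_dvd_modulus in_prime_factors_imp_dvd[OF that] by (metis of_nat_dvd_iff)
  then show ?thesis
    unfolding Jacobi_def by (intro arg_cong[of _ _ prod_mset] image_mset_cong Legendre_cong)
qed

lemma odd_prime_factors_gt_2:
  fixes Q :: nat
  assumes "odd Q" "p \<in> prime_factors Q"
  shows "prime p \<and> p > 2"
  using assms odd_prime_gt_2 by (meson dvd_trans in_prime_factors_iff)

lemma Jacobi_mult:
  assumes "odd Q"
  shows "Jacobi (a * b) Q = Jacobi a Q * Jacobi b Q"
  unfolding Jacobi_def prod_mset.distrib[symmetric]
  using odd_prime_factors_gt_2[OF assms]
  by (intro arg_cong[of _ _ prod_mset] image_mset_cong) (simp add: Legendre_mult)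

lemma Jacobi_minus_one_cases:
  assumes "odd Q"
  shows "Jacobi (- 1) Q = 1 \<or> Jacobi (- 1) Q = - 1"
proof -
  have "Jacobi 1 Q = 1"
    unfolding Jacobi_def
    by (intro prod_mset.neutral) (auto intro: Legendre_one in_prime_factors_imp_prime)
  then have "Jacobi (- 1) Q * Jacobi (- 1) Q = 1" by (simp flip: Jacobi_mult[OF assms])
  then show ?thesis by (simp add: square_eq_1_iff)
qed

lemma Jacobi_diff:
  assumes "odd Q" "Q dvd n" "j \<le> n"
  shows "Jacobi (int (n - j)) Q = Jacobi (- 1) Q * Jacobi (int j) Q"
proof -
  have "[int (n - j) = - 1 * int j] (mod int Q)"
    using assms(2,3) by (simp add: cong_iff_dvd_diff of_nat_diff)
  then show ?thesis using Jacobi_cong Jacobi_mult[OF assms(1)] by metis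
qed

subsection \<open>Polynomials over a subring\<close>

locale coefficient_subring =
  fixes K :: "'a::field set"
  assumes one_in: "1 \<in> K"
    and diff_in: "x \<in> K \<Longrightarrow> y \<in> K \<Longrightarrow> x - y \<in> K"
    and mult_in: "x \<in> K \<Longrightarrow> y \<in> K \<Longrightarrow> x * y \<in> K"
begin

lemma zero_in: "0 \<in> K"
  using diff_in[OF one_in one_in] by simp

lemma add_in: "x \<in> K \<Longrightarrow> y \<in> K \<Longrightarrow> x + y \<in> K"
  using diff_in[of x "0 - y"] diff_in[OF zero_in] by simp

lemma sum_in: "(\<And>i. i \<in> I \<Longrightarrow> h i \<in> K) \<Longrightarrow> sum h I \<in> K"
  by (induction I rule: infinite_finite_induct) (auto intro: zero_in add_in)

lemma polys_over_iff: "f \<in> polys_over K \<longleftrightarrow> (\<forall>i. coeff f i \<in> K)"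
proof -
  have "f \<in> polys_over K \<longleftrightarrow> range (coeff f) \<subseteq> K"
    using zero_in by (simp add: polys_over_def range_coeff)
  then show ?thesis by auto
qed

lemma one_in_polys_over: "1 \<in> polys_over K"
  using one_in by (simp add: polys_over_def)

lemma diff_in_polys_over: "f \<in> polys_over K \<Longrightarrow> h \<in> polys_over K \<Longrightarrow> f - h \<in> polys_over K"
  by (simp add: polys_over_iff diff_in)

lemma mult_in_polys_over: "f \<in> polys_over K \<Longrightarrow> h \<in> polys_over K \<Longrightarrow> f * h \<in> polys_over K"
  by (auto simp: polys_over_iff coeff_mult intro!: sum_in mult_in)

lemma monom_in_polys_over: "c \<in> K \<Longrightarrow> monom c k \<in> polys_over K"
  by (simp add: polys_over_iff zero_in)

lemma reflect_poly_in_polys_over: "f \<in> polys_over K \<Longrightarrow> reflect_poly f \<in> polys_over K"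
  by (simp add: polys_over_iff coeff_reflect_poly zero_in)

lemma div_mod_monic_in_polys_over:
  assumes "f \<in> polys_over K" "lead_coeff f = 1" "h \<in> polys_over K"
  shows "h div f \<in> polys_over K \<and> h mod f \<in> polys_over K"
  using assms(3)
proof (induction h)
  case 0
  then show ?case by simp
next
  case (pCons a h)
  have "a \<in> K" "h \<in> polys_over K"
    using pCons.prems by (auto simp: polys_over_iff coeff_pCons split: nat.splits)
  have "f \<noteq> 0" using assms(2) by auto
  note IH = pCons.IH[OF \<open>h \<in> polys_over K\<close>]
  define b where "b = coeff (pCons a (h mod f)) (degree f)"
  have "b \<in> K"
    using IH \<open>a \<in> K\<close> unfolding b_def by (auto simp: polys_over_iff coeff_pCons split: nat.splits)
  have "pCons a h div f = pCons b (h div f)"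
    using \<open>f \<noteq> 0\<close> assms(2) by (simp add: div_pCons_eq b_def)
  moreover have "pCons a h mod f = pCons a (h mod f) - smult b f"
    using \<open>f \<noteq> 0\<close> assms(2) by (simp add: mod_pCons_eq b_def)
  ultimately show ?case
    using IH \<open>a \<in> K\<close> \<open>b \<in> K\<close> assms(1)
    by (auto simp: polys_over_iff coeff_pCons intro!: diff_in mult_in split: nat.splits)
qed

end

subsection \<open>Polynomials with prescribed simple roots\<close>

definition poly_with_roots :: "'a::field set \<Rightarrow> 'a poly" where
  "poly_with_roots Z = (\<Prod>z\<in>Z. [:- z, 1:])"

lemma poly_poly_with_roots_eq_0_iff:
  assumes "finite Z"
  shows "poly (poly_with_roots Z) x = 0 \<longleftrightarrow> x \<in> Z"
  using assms by (auto simp: poly_with_roots_def poly_prod)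

lemma lead_coeff_poly_with_roots: "lead_coeff (poly_with_roots Z) = 1"
  by (simp add: poly_with_roots_def lead_coeff_prod)

lemma degree_poly_with_roots: "degree (poly_with_roots Z) = card Z"
  by (simp add: poly_with_roots_def degree_prod_eq_sum_degree)

lemma poly_with_roots_dvd:
  assumes "finite Z" "\<And>z. z \<in> Z \<Longrightarrow> poly c z = 0"
  shows "poly_with_roots Z dvd c"
proof (cases "Z = {}")
  case True
  then show ?thesis by (simp add: poly_with_roots_def)
next
  case False
  let ?f = "poly_with_roots Z"
  have "?f \<noteq> 0" using lead_coeff_poly_with_roots[of Z] by auto
  have "card Z > 0" using False assms(1) by (simp add: card_gt_0_iff)
  have "c mod ?f = 0"
  proof (rule poly_eqI_degree[of Z])
    show "poly (c mod ?f) z = poly 0 z" if "z \<in> Z" for z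
      using that assms by (simp add: poly_mod poly_poly_with_roots_eq_0_iff)
    show "degree (c mod ?f) < card Z"
      using degree_mod_less[OF \<open>?f \<noteq> 0\<close>, of c] \<open>card Z > 0\<close>
      by (auto simp: degree_poly_with_roots)
  qed (use \<open>card Z > 0\<close> in simp)
  then show ?thesis by (simp add: mod_eq_0_iff_dvd)
qed

lemma eq_0_if_all_power_sums_eq_0:
  fixes a :: "'a::field \<Rightarrow> 'a"
  assumes "finite S" "\<And>k. (\<Sum>x\<in>S. a x * x ^ k) = 0" "y \<in> S"
  shows "a y = 0"
proof -
  have power_sums: "(\<Sum>x\<in>S. a x * poly f x) = 0" for f
  proof -
    have "(\<Sum>x\<in>S. a x * poly f x) = (\<Sum>x\<in>S. \<Sum>i\<le>degree f. coeff f i * (a x * x ^ i))"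
      by (simp add: poly_altdef sum_distrib_left mult_ac)
    also have "\<dots> = (\<Sum>i\<le>degree f. coeff f i * (\<Sum>x\<in>S. a x * x ^ i))"
      by (subst sum.swap) (simp add: sum_distrib_left)
    finally show ?thesis by (simp add: assms(2))
  qed
  let ?f = "poly_with_roots (S - {y})"
  have "0 = (\<Sum>x\<in>S. a x * poly ?f x)" by (simp add: power_sums)
  also have "\<dots> = (\<Sum>x\<in>{y}. a x * poly ?f x)"
    using assms(1,3) by (intro sum.mono_neutral_right) (auto simp: poly_poly_with_roots_eq_0_iff)
  finally show ?thesis using assms(1) by (simp add: poly_poly_with_roots_eq_0_iff)
qed

subsection \<open>Roots of unity\<close>

locale unity_root =
  fixes n :: nat and \<theta> :: "'a::field"
  assumes n_pos: "n > 0" and prim: "prim_root_unity n \<theta>"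
begin

definition unity_roots :: "'a set" where
  "unity_roots = {x. x ^ n = 1}"

lemma theta_nonzero: "\<theta> \<noteq> 0"
  using prim n_pos by (auto simp: prim_root_unity_def power_0_left)

lemma theta_power_eq_iff:
  assumes "i < n" "j < n"
  shows "\<theta> ^ i = \<theta> ^ j \<longleftrightarrow> i = j"
proof -
  have "\<theta> ^ i \<noteq> \<theta> ^ j" if "i < j" "j < n" for i j
  proof
    assume "\<theta> ^ i = \<theta> ^ j"
    also have "\<theta> ^ j = \<theta> ^ i * \<theta> ^ (j - i)" using that(1) by (simp flip: power_add)
    finally have "\<theta> ^ (j - i) = 1" using theta_nonzero by simp
    then show False using prim that by (auto simp: prim_root_unity_def)
  qed
  then show ?thesis using assms by (metis linorder_neqE_nat)
qed

lemma inj_on_theta_power: "inj_on (\<lambda>j. \<theta> ^ j) {..<n}"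
  using theta_power_eq_iff by (auto simp: inj_on_def)

text \<open>Otherwise $n = r m$ for the characteristic $r$, and $(\theta^m - 1)^r = \theta^n - 1 = 0$.\<close>

lemma of_nat_n_nonzero: "of_nat n \<noteq> (0::'a)"
proof
  assume "of_nat n = (0::'a)"
  then obtain m where n_eq: "n = CHAR('a) * m"
    by (auto simp: of_nat_eq_0_iff_char_dvd elim: dvdE)
  then have "CHAR('a) > 0" "m > 0" using n_pos by auto
  then have "prime CHAR('a)" by (intro prime_CHAR_semidom)
  then have "(\<theta> ^ m - 1) ^ CHAR('a) + 1 ^ CHAR('a) = (\<theta> ^ m - 1 + 1) ^ CHAR('a)"
    by (intro freshmans_dream[symmetric] refl)
  also have "\<dots> = 1" using prim n_eq by (simp add: prim_root_unity_def mult.commute flip: power_mult)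
  finally have "\<theta> ^ m = 1" by simp
  moreover have "m < n" using n_eq \<open>m > 0\<close> prime_gt_1_nat[OF \<open>prime CHAR('a)\<close>] by simp
  ultimately show False using prim \<open>m > 0\<close> by (simp add: prim_root_unity_def)
qed

lemma theta_in_unity_roots: "\<theta> \<in> unity_roots"
  using prim by (simp add: unity_roots_def prim_root_unity_def)

lemma mult_in_unity_roots: "x \<in> unity_roots \<Longrightarrow> y \<in> unity_roots \<Longrightarrow> x * y \<in> unity_roots"
  by (simp add: unity_roots_def power_mult_distrib)

lemma inverse_in_unity_roots: "x \<in> unity_roots \<Longrightarrow> inverse x \<in> unity_roots"
  by (simp add: unity_roots_def power_inverse)

lemma power_in_unity_roots: "x \<in> unity_roots \<Longrightarrow> x ^ k \<in> unity_roots"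
  by (simp add: unity_roots_def mult.commute[of k n] flip: power_mult) (simp add: power_mult)

lemma unity_roots_nonzero: "x \<in> unity_roots \<Longrightarrow> x \<noteq> 0"
  using n_pos by (auto simp: unity_roots_def power_0_left)

abbreviation modulus :: "'a poly" where
  "modulus \<equiv> monom 1 n - 1"

lemma degree_modulus: "degree modulus = n"
  and lead_coeff_modulus: "lead_coeff modulus = 1"
proof -
  show degree: "degree modulus = n"
    using n_pos degree_add_eq_left[of "- 1 :: 'a poly" "monom 1 n"] by (simp add: degree_monom_eq)
  show "lead_coeff modulus = 1" unfolding degree using n_pos by simp
qed

lemma modulus_nonzero: "modulus \<noteq> 0"
  using lead_coeff_modulus by fastforce

lemma poly_modulus_eq_0_iff: "poly modulus x = 0 \<longleftrightarrow> x \<in> unity_roots"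
  by (simp add: unity_roots_def poly_monom)

lemma finite_unity_roots: "finite unity_roots"
  and card_unity_roots_le: "card unity_roots \<le> n"
proof -
  have "unity_roots = {x. poly modulus x = 0}" by (auto simp: poly_modulus_eq_0_iff[symmetric])
  then show "finite unity_roots" "card unity_roots \<le> n"
    using modulus_nonzero poly_roots_finite card_poly_roots_bound degree_modulus by metis+
qed

lemma unity_roots_eq: "unity_roots = (\<lambda>j. \<theta> ^ j) ` {..<n}"
proof (rule sym, rule card_seteq[OF finite_unity_roots])
  show "(\<lambda>j. \<theta> ^ j) ` {..<n} \<subseteq> unity_roots" using power_in_unity_roots theta_in_unity_roots by blast
  show "card unity_roots \<le> card ((\<lambda>j. \<theta> ^ j) ` {..<n})"
    using card_unity_roots_le by (simp add: card_image inj_on_theta_power)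
qed

lemma card_unity_roots: "card unity_roots = n"
  by (simp add: unity_roots_eq card_image inj_on_theta_power)

lemma modulus_eq_poly_with_roots: "modulus = poly_with_roots unity_roots"
proof (rule poly_eqI_degree_lead_coeff[of _ n _ unity_roots])
  show "coeff modulus n = coeff (poly_with_roots unity_roots) n"
    using lead_coeff_poly_with_roots[of unity_roots] lead_coeff_modulus
    by (simp add: degree_poly_with_roots card_unity_roots degree_modulus)
  show "poly modulus z = poly (poly_with_roots unity_roots) z" if "z \<in> unity_roots" for z
    using that poly_modulus_eq_0_iff poly_poly_with_roots_eq_0_iff[OF finite_unity_roots] by metis
qed (simp_all add: card_unity_roots degree_modulus degree_poly_with_roots)

lemma sum_powers_unity_root:
  assumes "x \<in> unity_roots"
  shows "(\<Sum>k<n. x ^ k) = (if x = 1 then of_nat n else 0)"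
proof -
  have "(x - 1) * (\<Sum>k<n. x ^ k) = 0"
    using assms by (simp add: unity_roots_def flip: power_diff_1_eq)
  then show ?thesis by auto
qed

lemma sum_unity_roots_orthogonal:
  assumes "i < n" "l < n"
  shows "(\<Sum>x\<in>unity_roots. inverse x ^ i * x ^ l) = (if i = l then of_nat n else 0)"
proof -
  have "(\<Sum>x\<in>unity_roots. inverse x ^ i * x ^ l) = (\<Sum>j<n. inverse (\<theta> ^ j) ^ i * (\<theta> ^ j) ^ l)"
    unfolding unity_roots_eq by (simp add: sum.reindex[OF inj_on_theta_power])
  also have "\<dots> = (\<Sum>j<n. (inverse (\<theta> ^ i) * \<theta> ^ l) ^ j)"
    by (simp add: power_mult_distrib power_inverse mult.commute flip: power_mult)
  also have "\<dots> = (if inverse (\<theta> ^ i) * \<theta> ^ l = 1 then of_nat n else 0)"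
    by (intro sum_powers_unity_root mult_in_unity_roots inverse_in_unity_roots
        power_in_unity_roots theta_in_unity_roots)
  also have "inverse (\<theta> ^ i) * \<theta> ^ l = 1 \<longleftrightarrow> i = l"
    using theta_power_eq_iff[OF assms] theta_nonzero by (auto simp: field_simps)
  finally show ?thesis .
qed

lemma inner_product_fourier:
  fixes v c :: "'a poly"
  assumes "degree v < n" "degree c < n"
  shows "of_nat n * (\<Sum>i<n. coeff v i * coeff c i) =
    (\<Sum>x\<in>unity_roots. poly v (inverse x) * poly c x)"
proof -
  have expand: "poly f x = (\<Sum>i<n. coeff f i * x ^ i)" if "degree f < n" for f :: "'a poly" and x
    using that unfolding poly_altdef
    by (intro sum.mono_neutral_left) (auto intro: coeff_eq_0)
  have "(\<Sum>x\<in>unity_roots. poly v (inverse x) * poly c x) =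
      (\<Sum>x\<in>unity_roots. \<Sum>i<n. \<Sum>l<n. coeff v i * coeff c l * (inverse x ^ i * x ^ l))"
    unfolding expand[OF assms(1)] expand[OF assms(2)] sum_product by (simp add: mult_ac)
  also have "\<dots> =
      (\<Sum>i<n. \<Sum>x\<in>unity_roots. \<Sum>l<n. coeff v i * coeff c l * (inverse x ^ i * x ^ l))"
    by (rule sum.swap)
  also have "\<dots> =
      (\<Sum>i<n. \<Sum>l<n. coeff v i * coeff c l * (\<Sum>x\<in>unity_roots. inverse x ^ i * x ^ l))"
    by (subst sum.swap) (simp add: sum_distrib_left)
  also have "\<dots> = (\<Sum>i<n. \<Sum>l<n. if i = l then of_nat n * (coeff v i * coeff c l) else 0)"
    by (intro sum.cong refl) (simp add: sum_unity_roots_orthogonal)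
  also have "\<dots> = of_nat n * (\<Sum>i<n. coeff v i * coeff c i)"
    by (simp add: sum.delta sum_distrib_left)
  finally show ?thesis by simp
qed

end

subsection \<open>Cyclic codes and their zeros\<close>

locale cyclic_code_roots = unity_root n \<theta> + coefficient_subring K
  for n :: nat and \<theta> :: "'a::field" and K :: "'a set" +
  fixes Z :: "'a set"
  assumes Z_subset: "Z \<subseteq> unity_roots"
    and generator_in_polys_over: "poly_with_roots Z \<in> polys_over K"
begin

abbreviation generator :: "'a poly" where
  "generator \<equiv> poly_with_roots Z"

abbreviation code :: "'a poly set" where
  "code \<equiv> cyclic_code K n generator"

lemma finite_Z: "finite Z"
  using Z_subset finite_unity_roots finite_subset by blast

lemma modulus_in_polys_over: "modulus \<in> polys_over K"
  by (intro diff_in_polys_over monom_in_polys_over one_in one_in_polys_over)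

lemma mod_modulus_in_words:
  assumes "h \<in> polys_over K"
  shows "h mod modulus \<in> words K n"
proof -
  have "degree (h mod modulus) < n"
    using degree_mod_less[OF modulus_nonzero, of h] n_pos by (auto simp: degree_modulus)
  then show ?thesis
    using div_mod_monic_in_polys_over[OF modulus_in_polys_over lead_coeff_modulus assms]
    by (simp add: words_def)
qed

lemma poly_mod_modulus: "x \<in> unity_roots \<Longrightarrow> poly (h mod modulus) x = poly h x"
  by (intro poly_mod) (simp only: poly_modulus_eq_0_iff)

lemma mod_modulus_in_code:
  "h \<in> polys_over K \<Longrightarrow> (h * generator) mod modulus \<in> code"
  by (auto simp: cyclic_code_def)

lemma in_code_iff: "c \<in> code \<longleftrightarrow> c \<in> words K n \<and> (\<forall>z\<in>Z. poly c z = 0)"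
proof (intro iffI conjI)
  assume "c \<in> code"
  then obtain h where c_eq: "h \<in> polys_over K" "c = (h * generator) mod modulus"
    by (auto simp: cyclic_code_def)
  then show "c \<in> words K n"
    by (simp add: mod_modulus_in_words mult_in_polys_over generator_in_polys_over)
  show "\<forall>z\<in>Z. poly c z = 0"
    using Z_subset c_eq(2) poly_mod_modulus poly_poly_with_roots_eq_0_iff[OF finite_Z] by auto
next
  assume c_word: "c \<in> words K n \<and> (\<forall>z\<in>Z. poly c z = 0)"
  then have "c = c div generator * generator"
    using poly_with_roots_dvd[OF finite_Z] by simp
  moreover have "c mod modulus = c"
    using c_word by (intro mod_poly_less) (simp add: words_def degree_modulus)
  moreover have "c div generator \<in> polys_over K"
    using c_word div_mod_monic_in_polys_over[OF generator_in_polys_over lead_coeff_poly_with_roots]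
    by (simp add: words_def)
  ultimately show "c \<in> code" using mod_modulus_in_code by metis
qed

lemma vanishes_if_in_dual_code:
  assumes "v \<in> dual_code K n code" "x \<in> unity_roots - Z"
  shows "poly v (inverse x) = 0"
proof -
  let ?a = "\<lambda>x. poly v (inverse x) * poly generator x"
  have "(\<Sum>x\<in>unity_roots. ?a x * x ^ k) = 0" for k
  proof -
    let ?c = "(monom 1 k * generator) mod modulus"
    have "?c \<in> code" by (intro mod_modulus_in_code monom_in_polys_over one_in)
    then have "degree v < n" "degree ?c < n" "(\<Sum>i<n. coeff v i * coeff ?c i) = 0"
      using assms(1) in_code_iff[of ?c] by (auto simp: dual_code_def words_def)
    then have "0 = (\<Sum>x\<in>unity_roots. poly v (inverse x) * poly ?c x)"
      using inner_product_fourier[of v ?c] by simp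
    also have "\<dots> = (\<Sum>x\<in>unity_roots. ?a x * x ^ k)"
      by (intro sum.cong refl) (simp add: poly_mod_modulus poly_monom mult_ac)
    finally show ?thesis by simp
  qed
  then have "?a x = 0"
    using eq_0_if_all_power_sums_eq_0[OF finite_unity_roots, of ?a] assms(2) by blast
  then show ?thesis using assms(2) by (simp add: poly_poly_with_roots_eq_0_iff[OF finite_Z])
qed

lemma in_dual_code_iff:
  "v \<in> dual_code K n code \<longleftrightarrow> v \<in> words K n \<and> (\<forall>x\<in>unity_roots - Z. poly v (inverse x) = 0)"
proof (intro iffI conjI)
  assume v_word: "v \<in> words K n \<and> (\<forall>x\<in>unity_roots - Z. poly v (inverse x) = 0)"
  have "(\<Sum>i<n. coeff v i * coeff c i) = 0" if "c \<in> code" for c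
  proof -
    have c_word: "c \<in> words K n" "\<forall>z\<in>Z. poly c z = 0" using that in_code_iff by auto
    then have "of_nat n * (\<Sum>i<n. coeff v i * coeff c i) =
        (\<Sum>x\<in>unity_roots. poly v (inverse x) * poly c x)"
      using v_word by (intro inner_product_fourier) (auto simp: words_def)
    also have "\<dots> = 0" using v_word c_word(2) by (intro sum.neutral) auto
    finally show ?thesis using of_nat_n_nonzero by simp
  qed
  then show "v \<in> dual_code K n code" using v_word by (simp add: dual_code_def)
qed (use vanishes_if_in_dual_code in \<open>auto simp: dual_code_def\<close>)

definition dual_generator :: "'a poly" where
  "dual_generator = reflect_poly (modulus div generator)"

lemma dual_generator_in_polys_over: "dual_generator \<in> polys_over K"
  unfolding dual_generator_def
  using div_mod_monic_in_polys_over[OF generator_in_polys_over lead_coeff_poly_with_roots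
      modulus_in_polys_over]
  by (intro reflect_poly_in_polys_over) blast

lemma poly_dual_generator_eq_0_iff:
  assumes "x \<in> unity_roots"
  shows "poly dual_generator x = 0 \<longleftrightarrow> inverse x \<notin> Z"
proof -
  have "modulus = poly_with_roots (unity_roots - Z) * generator"
    using prod.subset_diff[OF Z_subset finite_unity_roots]
    by (simp add: modulus_eq_poly_with_roots poly_with_roots_def)
  moreover have "generator \<noteq> 0" using lead_coeff_poly_with_roots[of Z] by auto
  ultimately have "modulus div generator = poly_with_roots (unity_roots - Z)" by simp
  then have "poly dual_generator x =
      x ^ degree (poly_with_roots (unity_roots - Z)) *
      poly (poly_with_roots (unity_roots - Z)) (inverse x)"
    using unity_roots_nonzero[OF assms] by (simp add: dual_generator_def poly_reflect_poly_nz)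
  then show ?thesis
    using unity_roots_nonzero[OF assms] inverse_in_unity_roots[OF assms] finite_unity_roots
    by (simp add: poly_poly_with_roots_eq_0_iff)
qed

lemma dual_generator_multiple_in_dual_code:
  assumes "h \<in> polys_over K"
  shows "(h * dual_generator) mod modulus \<in> dual_code K n code"
  unfolding in_dual_code_iff
proof (intro conjI ballI)
  show "(h * dual_generator) mod modulus \<in> words K n"
    by (intro mod_modulus_in_words mult_in_polys_over assms dual_generator_in_polys_over)
  show "poly ((h * dual_generator) mod modulus) (inverse x) = 0"
    if "x \<in> unity_roots - Z" for x
    using that inverse_in_unity_roots by (simp add: poly_mod_modulus poly_dual_generator_eq_0_iff)
qed

lemma LCD_code_iff: "LCD_code K n code \<longleftrightarrow> (\<forall>z\<in>Z. inverse z \<in> Z)"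
proof
  assume LCD: "LCD_code K n code"
  let ?w = "(generator * dual_generator) mod modulus"
  have "?w \<in> dual_code K n code"
    by (intro dual_generator_multiple_in_dual_code generator_in_polys_over)
  moreover have "?w \<in> code"
    using mod_modulus_in_code[OF dual_generator_in_polys_over] by (simp add: mult.commute)
  ultimately have "?w = 0" using LCD by (auto simp: LCD_code_def)
  show "\<forall>z\<in>Z. inverse z \<in> Z"
  proof
    fix z assume "z \<in> Z"
    then have "inverse z \<in> unity_roots" using Z_subset inverse_in_unity_roots by blast
    then have "poly (generator * dual_generator) (inverse z) = 0"
      using \<open>?w = 0\<close> poly_mod_modulus by (metis poly_0)
    then show "inverse z \<in> Z"
      using \<open>z \<in> Z\<close> \<open>inverse z \<in> unity_roots\<close>
      by (simp add: poly_poly_with_roots_eq_0_iff[OF finite_Z] poly_dual_generator_eq_0_iff)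
  qed
next
  assume sym: "\<forall>z\<in>Z. inverse z \<in> Z"
  have "0 \<in> words K n" using n_pos by (simp add: words_def polys_over_def)
  then have "0 \<in> code \<inter> dual_code K n code" by (simp add: in_code_iff in_dual_code_iff)
  moreover have "c = 0" if c_in: "c \<in> code" "c \<in> dual_code K n code" for c
  proof (rule poly_eqI_degree[of unity_roots])
    show "poly c x = poly 0 x" if "x \<in> unity_roots" for x
    proof (cases "x \<in> Z")
      case True
      then show ?thesis using c_in(1) in_code_iff by simp
    next
      case False
      then have "inverse x \<in> unity_roots - Z" using that sym inverse_in_unity_roots by force
      then show ?thesis using c_in(2) in_dual_code_iff by force
    qed
  qed (use c_in n_pos in \<open>auto simp: in_code_iff words_def card_unity_roots\<close>)
  ultimately show "LCD_code K n code" by (auto simp: LCD_code_def)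
qed

lemma self_orthogonal_iff: "self_orthogonal K n code \<longleftrightarrow> (\<forall>z\<in>Z. inverse z \<notin> Z)"
proof
  assume "self_orthogonal K n code"
  then have "dual_code K n code \<subseteq> code" by (auto simp: self_orthogonal_def)
  then have "(1 * dual_generator) mod modulus \<in> code"
    using dual_generator_multiple_in_dual_code[OF one_in_polys_over] by blast
  then have "poly dual_generator z = 0" if "z \<in> Z" for z
    using that Z_subset poly_mod_modulus[of z dual_generator] by (auto simp: in_code_iff)
  then show "\<forall>z\<in>Z. inverse z \<notin> Z"
    using Z_subset poly_dual_generator_eq_0_iff by blast
next
  assume asym: "\<forall>z\<in>Z. inverse z \<notin> Z"
  have "v \<in> code" if v_dual: "v \<in> dual_code K n code" for v
  proof -
    have "poly v z = 0" if "z \<in> Z" for z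
    proof -
      have "inverse z \<in> unity_roots - Z" using that asym Z_subset inverse_in_unity_roots by blast
      then show ?thesis using v_dual in_dual_code_iff by force
    qed
    then show ?thesis using v_dual by (simp add: in_code_iff in_dual_code_iff)
  qed
  then show "self_orthogonal K n code" by (auto simp: self_orthogonal_def)
qed

lemma common_zeros_code: "{x \<in> unity_roots. \<forall>c\<in>code. poly c x = 0} = Z"
proof (intro equalityI subsetI)
  fix x assume common_zero: "x \<in> {x \<in> unity_roots. \<forall>c\<in>code. poly c x = 0}"
  then have "poly ((1 * generator) mod modulus) x = 0"
    using mod_modulus_in_code[OF one_in_polys_over] by blast
  then show "x \<in> Z" using common_zero
    by (simp add: poly_mod_modulus poly_poly_with_roots_eq_0_iff[OF finite_Z])
qed (use Z_subset in_code_iff in auto)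

end

subsection \<open>The Jacobi classes of the residues with a given gcd\<close>

lemma M_set_bounds: "j \<in> M_set n d \<Longrightarrow> 0 < j \<and> j < n"
  by (auto simp: M_set_def)

lemma M_set_unique: "j \<in> M_set n d \<Longrightarrow> j \<in> M_set n d' \<Longrightarrow> d = d'"
  by (simp add: M_set_def)

lemma finite_M_eps: "finite (M_eps n d Q e)"
  by (rule finite_subset[of _ "{..<n}"]) (auto simp: M_eps_def dest: M_set_bounds)

lemma minus_in_M_set:
  assumes "j \<in> M_set n d"
  shows "n - j \<in> M_set n d"
proof -
  have "j \<le> n" using M_set_bounds[OF assms] by simp
  then have "gcd (n - j) n = gcd j n"
    by (metis gcd.commute gcd_diff1_nat gcd_diff2_nat diff_le_self)
  then show ?thesis using assms M_set_bounds[OF assms] by (auto simp: M_set_def)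
qed

definition proper_divisors :: "nat \<Rightarrow> nat set" where
  "proper_divisors n = {d. d dvd n \<and> d \<noteq> n}"

lemma cofactor_dvd: "d dvd n \<Longrightarrow> n div d dvd n" for n d :: nat
  by (metis dvd_mult_div_cancel dvd_triv_right)

locale odd_squarefree =
  fixes n :: nat
  assumes odd_n: "odd n" and squarefree_n: "squarefree n"
begin

lemma n_nonzero: "n \<noteq> 0"
  using odd_n by (metis even_zero)

lemma finite_proper_divisors: "finite (proper_divisors n)"
proof -
  have "finite {d. d dvd n}" using n_nonzero by simp
  then show ?thesis unfolding proper_divisors_def by (rule rev_finite_subset) blast
qed

context
  fixes d :: nat
  assumes d_proper: "d \<in> proper_divisors n"
begin

lemma d_dvd_n: "d dvd n" and d_neq_n: "d \<noteq> n"
  using d_proper by (simp_all add: proper_divisors_def)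

lemma cofactor_gt_1: "n div d > 1"
proof -
  have "n = n div d * d" using d_dvd_n by simp
  then show ?thesis
    using d_neq_n n_nonzero by (metis One_nat_def Suc_lessI mult_0 mult_1 neq0_conv)
qed

lemma M_star_dvd: "Q \<in> M_star n d \<Longrightarrow> Q dvd n"
  using cofactor_dvd[OF d_dvd_n] dvd_trans by (auto simp: M_star_def)

lemma M_star_squarefree: "Q \<in> M_star n d \<Longrightarrow> squarefree Q"
  using M_star_dvd squarefree_n squarefree_mono by blast

lemma M_star_odd: "Q \<in> M_star n d \<Longrightarrow> odd Q"
  using M_star_dvd odd_n dvd_trans by blast

lemma ex_M_set_prescribed_Legendre:
  assumes "\<And>p. s p \<in> {1, -1}"
  shows "\<exists>j\<in>M_set n d. \<forall>p\<in>prime_factors (n div d). Legendre (int j) (int p) = s p"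
proof -
  define s' where "s' p = (if p dvd d then 0 else s p)" for p
  have s'_values: "s' p \<in> {0, 1, -1}" and s'_eq_0_iff: "s' p = 0 \<longleftrightarrow> p dvd d" for p
    using assms[of p] by (auto simp: s'_def)
  obtain x :: nat where symbol_x: "\<And>p. p \<in> prime_factors n \<Longrightarrow> Legendre (int x) (int p) = s' p"
    using ex_prescribed_Legendre[of "prime_factors n" s'] odd_prime_factors_gt_2[OF odd_n] s'_values
    by blast
  have "p dvd x \<longleftrightarrow> p dvd d" if "p \<in> prime_factors n" for p
  proof -
    have "p dvd x \<longleftrightarrow> Legendre (int x) (int p) = 0" by (simp add: Legendre_def cong_0_iff)
    then show ?thesis by (simp add: symbol_x[OF that] s'_eq_0_iff)
  qed
  then have "gcd x n = d" by (rule gcd_squarefree_eqI[OF squarefree_n d_dvd_n])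
  moreover have "x mod n \<noteq> 0" "x mod n < n"
    using calculation d_neq_n n_nonzero by (auto simp: mod_eq_0_iff_dvd)
  ultimately have "x mod n \<in> M_set n d" by (auto simp: M_set_def)
  moreover have "Legendre (int (x mod n)) (int p) = s p" if "p \<in> prime_factors (n div d)" for p
  proof -
    have "p \<in> prime_factors n"
      using that cofactor_dvd[OF d_dvd_n] n_nonzero dvd_prime_factors by blast
    then have "[x mod n = x] (mod p)"
      by (simp add: cong_def mod_mod_cancel in_prime_factors_imp_dvd)
    then have "Legendre (int (x mod n)) (int p) = s' p"
      using Legendre_cong symbol_x[OF \<open>p \<in> prime_factors n\<close>] by (metis cong_int_iff)
    moreover have "coprime d (n div d)"
      using squarefree_mult_imp_coprime squarefree_n d_dvd_n by (metis dvd_mult_div_cancel)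
    then have "\<not> p dvd d"
      using that coprime_common_divisor not_prime_unit by (metis in_prime_factors_iff)
    ultimately show ?thesis by (simp add: s'_def)
  qed
  ultimately show ?thesis by blast
qed

lemma ex_M_set_Jacobi:
  assumes "prime a" "s \<in> {1, -1}"
  shows "\<exists>j\<in>M_set n d. \<forall>Q\<in>M_star n d. Jacobi (int j) Q = (if a dvd Q then s else 1)"
proof -
  have "(if p = a then s else 1) \<in> {1, -1}" for p using assms(2) by simp
  from ex_M_set_prescribed_Legendre[of "\<lambda>p. if p = a then s else 1", OF this]
  obtain j where "j \<in> M_set n d" and symbols_j:
    "\<And>p. p \<in> prime_factors (n div d) \<Longrightarrow> Legendre (int j) (int p) = (if p = a then s else 1)"
    by blast
  have "Jacobi (int j) Q = (if a dvd Q then s else 1)" if Q_in: "Q \<in> M_star n d" for Q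
  proof -
    have "prime_factors Q \<subseteq> prime_factors (n div d)"
      using Q_in cofactor_gt_1 by (intro dvd_prime_factors) (auto simp: M_star_def)
    then have "Jacobi (int j) Q = (\<Prod>p\<in>prime_factors Q. if p = a then s else 1)"
      unfolding Jacobi_squarefree[OF M_star_squarefree[OF Q_in]]
      using symbols_j by (intro prod.cong) auto
    also have "\<dots> = (if a dvd Q then s else 1)"
      using assms(1) Q_in by (auto simp: prime_factors_dvd M_star_def)
    finally show ?thesis .
  qed
  then show ?thesis using \<open>j \<in> M_set n d\<close> by blast
qed

lemma M_eps_nonempty:
  assumes Q_in: "Q \<in> M_star n d" and sign: "e \<in> {1, -1}"
  shows "M_eps n d Q e \<noteq> {}"
proof -
  obtain a where "prime a" "a dvd Q"
    using Q_in prime_factor_nat[of Q] by (auto simp: M_star_def)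
  then obtain j where "j \<in> M_set n d" "Jacobi (int j) Q = e"
    using ex_M_set_Jacobi[OF _ sign] Q_in by metis
  then show ?thesis by (auto simp: M_eps_def)
qed

text \<open>The residues used are one with all Legendre symbols $1$ and, for each prime $a$, one whose
  only Legendre symbol $-1$ is that at $a$.\<close>

lemma M_eps_eq_iff:
  assumes Q_in: "Q \<in> M_star n d" "Q' \<in> M_star n d" and signs: "e \<in> {1, -1}" "e' \<in> {1, -1}"
  shows "M_eps n d Q e = M_eps n d Q' e' \<longleftrightarrow> Q = Q' \<and> e = e'"
proof
  assume "M_eps n d Q e = M_eps n d Q' e'"
  then have same: "Jacobi (int j) Q = e \<longleftrightarrow> Jacobi (int j) Q' = e'" if "j \<in> M_set n d" for j
    using that by (auto simp: M_eps_def)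
  obtain j where "j \<in> M_set n d" "Jacobi (int j) Q = 1" "Jacobi (int j) Q' = 1"
    using ex_M_set_Jacobi[OF two_is_prime_nat, of "1 :: int"] Q_in by auto
  then have "e = e'" using same signs by force
  have "a dvd Q \<longleftrightarrow> a dvd Q'" if prime_a: "prime a" for a
  proof -
    obtain j where "j \<in> M_set n d" "Jacobi (int j) Q = (if a dvd Q then - 1 else 1)"
      "Jacobi (int j) Q' = (if a dvd Q' then - 1 else 1)"
      using ex_M_set_Jacobi[OF prime_a, of "- 1"] Q_in by fastforce
    then show ?thesis using same[of j] signs \<open>e = e'\<close> by (auto split: if_splits)
  qed
  moreover have "Q \<noteq> 0" "Q' \<noteq> 0" using Q_in by (auto simp: M_star_def)
  ultimately have "prime_factors Q = prime_factors Q'" by (auto simp: prime_factors_dvd)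
  then show "Q = Q' \<and> e = e'"
    using squarefree_nat_eqI M_star_squarefree Q_in \<open>e = e'\<close> by blast
qed simp

end

end

subsection \<open>Products of distinct odd primes\<close>

locale distinct_odd_primes =
  fixes p :: "nat \<Rightarrow> nat" and g n :: nat
  assumes odd_primes: "i \<in> {1..g} \<Longrightarrow> prime (p i) \<and> odd (p i)"
    and inj_p: "inj_on p {1..g}"
    and n_eq: "n = (\<Prod>i\<in>{1..g}. p i)"
begin

sublocale odd_squarefree n
proof
  show "odd n" unfolding n_eq using odd_primes by (simp add: even_prod_iff)
  show "squarefree n"
    unfolding n_eq using inj_p odd_primes by (intro squarefree_prod_primes) auto
qed

lemma prod_p_nonzero:
  assumes "S \<subseteq> {1..g}"
  shows "(\<Prod>i\<in>S. p i) \<noteq> 0"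
proof -
  have "finite S" using assms finite_subset by blast
  moreover have "p i \<noteq> 0" if "i \<in> S" for i
    using odd_primes assms that by (metis not_prime_0 subsetD)
  ultimately show ?thesis by simp
qed

lemma bij_betw_subsets_divisors: "bij_betw (\<lambda>S. \<Prod>i\<in>S. p i) (Pow {1..g}) {d. d dvd n}"
  unfolding n_eq using inj_p odd_primes by (intro bij_betw_prod_Pow_divisors) auto

lemma inj_on_prod_subsets: "inj_on (\<lambda>S. \<Prod>i\<in>S. p i) (Pow {1..g})"
  using bij_betw_subsets_divisors by (rule bij_betw_imp_inj_on)

lemma A_set_eq_image: "A_set p g r = (\<lambda>S. \<Prod>i\<in>S. p i) ` {S. S \<subseteq> {1..g} \<and> card S = r}"
  by (auto simp: A_set_def)

lemma finite_A_set: "finite (A_set p g r)"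
  by (simp add: A_set_eq_image)

lemma card_A_set: "card (A_set p g r) = g choose r"
proof -
  have "inj_on (\<lambda>S. \<Prod>i\<in>S. p i) {S. S \<subseteq> {1..g} \<and> card S = r}"
    by (rule inj_on_subset[OF inj_on_prod_subsets]) auto
  then show ?thesis by (simp add: A_set_eq_image card_image n_subsets)
qed

lemma A_set_disjoint:
  assumes "r \<noteq> s"
  shows "A_set p g r \<inter> A_set p g s = {}"
proof -
  let ?subsets = "\<lambda>r. {S. S \<subseteq> {1..g} \<and> card S = r}"
  have "A_set p g r \<inter> A_set p g s = (\<lambda>S. \<Prod>i\<in>S. p i) ` (?subsets r \<inter> ?subsets s)"
    unfolding A_set_eq_image by (rule inj_on_image_Int[OF inj_on_prod_subsets, symmetric]) auto
  also have "?subsets r \<inter> ?subsets s = {}" using assms by blast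
  finally show ?thesis by simp
qed

lemma Union_A_set: "(\<Union>r<g. A_set p g r) = proper_divisors n"
proof -
  have "(\<Union>r<g. A_set p g r) = (\<lambda>S. \<Prod>i\<in>S. p i) ` (Pow {1..g} - {{1..g}})"
  proof -
    have "card S < g \<longleftrightarrow> S \<noteq> {1..g}" if "S \<subseteq> {1..g}" for S
      using that psubset_card_mono[of "{1..g}" S] by auto
    then have "(\<Union>r<g. {S. S \<subseteq> {1..g} \<and> card S = r}) = Pow {1..g} - {{1..g}}" by auto
    then show ?thesis unfolding A_set_eq_image by (simp flip: image_UN)
  qed
  also have "\<dots> = {d. d dvd n} - {n}"
    using inj_on_image_set_diff[OF inj_on_prod_subsets, of "Pow {1..g}" "{{1..g}}"]
      bij_betw_imp_surj_on[OF bij_betw_subsets_divisors] by (simp add: n_eq)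
  also have "\<dots> = proper_divisors n" by (auto simp: proper_divisors_def)
  finally show ?thesis .
qed

lemma card_M_star:
  assumes "d \<in> A_set p g r"
  shows "card (M_star n d) = 2 ^ (g - r) - 1"
proof -
  obtain S where d_eq: "S \<subseteq> {1..g}" "card S = r" "d = (\<Prod>i\<in>S. p i)"
    using assms by (auto simp: A_set_def)
  have "d \<noteq> 0" unfolding d_eq(3) using d_eq(1) by (rule prod_p_nonzero)
  then have cofactor: "n div d = (\<Prod>i\<in>{1..g} - S. p i)"
    unfolding n_eq d_eq(3) prod.subset_diff[OF d_eq(1) finite_atLeastAtMost] by simp
  have "inj_on p ({1..g} - S)" using inj_p inj_on_subset by blast
  then have "card {Q. Q dvd n div d} = 2 ^ (g - r)"
    unfolding cofactor using d_eq odd_primes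
    by (subst card_divisors_prod_primes) (auto simp: card_Diff_subset finite_subset)
  moreover have "n div d \<noteq> 0" unfolding cofactor by (rule prod_p_nonzero) blast
  then have "M_star n d = {Q. Q dvd n div d} - {1}"
    by (auto simp: M_star_def intro: Suc_lessI)
  ultimately show ?thesis by (simp add: card_Diff_singleton)
qed

lemma M_star_maximal_divisor:
  assumes "i \<in> {1..g}"
  shows "n div p i \<in> proper_divisors n" "M_star n (n div p i) = {p i}"
proof -
  have prime_p_i: "prime (p i)" using odd_primes assms by blast
  have "p i dvd n" unfolding n_eq using assms by (intro dvd_prodI) auto
  moreover have "n > 0" using n_nonzero by simp
  ultimately have cofactor: "n div (n div p i) = p i" "n div p i < n" "n div p i dvd n"
    using prime_gt_1_nat[OF prime_p_i] by (auto simp: div_div_eq_right)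
  show "n div p i \<in> proper_divisors n" using cofactor by (simp add: proper_divisors_def)
  show "M_star n (n div p i) = {p i}"
    unfolding M_star_def cofactor using prime_p_i prime_gt_1_nat[OF prime_p_i]
    by (auto simp: prime_nat_iff)
qed

lemma QR_choice_iff:
  "QR_choice p g n Q \<epsilon> \<longleftrightarrow> (\<forall>d\<in>proper_divisors n. Q d \<in> M_star n d \<and> \<epsilon> d \<in> {1, -1})"
  by (simp add: QR_choice_def Union_A_set)

lemma ex_QR_choice_Jacobi_minus_one_iff:
  "(\<exists>Q \<epsilon>. QR_choice p g n Q \<epsilon> \<and> (\<forall>d\<in>proper_divisors n. Jacobi (- 1) (Q d) = s)) \<longleftrightarrow>
    (\<forall>i\<in>{1..g}. Legendre (- 1) (int (p i)) = s)"
proof (intro iffI ballI)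
  fix i assume i_range: "i \<in> {1..g}"
    and "\<exists>Q \<epsilon>. QR_choice p g n Q \<epsilon> \<and> (\<forall>d\<in>proper_divisors n. Jacobi (- 1) (Q d) = s)"
  then have "Jacobi (- 1) (p i) = s" using M_star_maximal_divisor[OF i_range] QR_choice_iff by force
  then show "Legendre (- 1) (int (p i)) = s" using Jacobi_prime odd_primes i_range by simp
next
  assume symbol: "\<forall>i\<in>{1..g}. Legendre (- 1) (int (p i)) = s"
  have "\<exists>Q. Q \<in> M_star n d \<and> Jacobi (- 1) Q = s" if "d \<in> proper_divisors n" for d
  proof -
    have "n div d \<noteq> 1" using cofactor_gt_1[OF that] by simp
    then obtain a where a_prime_factor: "prime a" "a dvd n div d" using prime_factor_nat by blast
    have "a dvd n" using a_prime_factor(2) cofactor_dvd[OF d_dvd_n[OF that]] dvd_trans by blast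
    then obtain i where "i \<in> {1..g}" "a = p i"
      unfolding n_eq using a_prime_factor(1) odd_primes
      by (auto simp: prime_dvd_prod_iff primes_dvd_imp_eq)
    then show ?thesis
      using a_prime_factor symbol prime_gt_1_nat[OF a_prime_factor(1)]
      by (auto simp: M_star_def Jacobi_prime)
  qed
  then obtain Q where "\<forall>d\<in>proper_divisors n. Q d \<in> M_star n d \<and> Jacobi (- 1) (Q d) = s" by metis
  then show "\<exists>Q \<epsilon>. QR_choice p g n Q \<epsilon> \<and> (\<forall>d\<in>proper_divisors n. Jacobi (- 1) (Q d) = s)"
    by (intro exI[of _ Q] exI[of _ "\<lambda>_. 1"]) (simp add: QR_choice_iff)
qed

end

subsection \<open>QR codes\<close>

locale QR_codes = unity_root n \<theta> + distinct_odd_primes p g n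
  for n :: nat and \<theta> :: "'a::field" and p :: "nat \<Rightarrow> nat" and g :: nat +
  fixes \<kappa> :: "'a poly \<Rightarrow> 'a set"
  assumes subring_base: "coefficient_subring (\<kappa> f)"
    and in_polys_over_base: "f \<in> polys_over (\<kappa> f)"
begin

abbreviation QR_gen :: "(nat \<Rightarrow> nat) \<Rightarrow> (nat \<Rightarrow> int) \<Rightarrow> 'a poly" where
  "QR_gen Q \<epsilon> \<equiv> QR_generator \<theta> p g n Q \<epsilon>"

definition code :: "(nat \<Rightarrow> nat) \<Rightarrow> (nat \<Rightarrow> int) \<Rightarrow> 'a poly set" where
  "code Q \<epsilon> = cyclic_code (\<kappa> (QR_gen Q \<epsilon>)) n (QR_gen Q \<epsilon>)"

definition exponents :: "(nat \<Rightarrow> nat) \<Rightarrow> (nat \<Rightarrow> int) \<Rightarrow> nat set" where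
  "exponents Q \<epsilon> = (\<Union>d\<in>proper_divisors n. M_eps n d (Q d) (\<epsilon> d))"

definition roots :: "(nat \<Rightarrow> nat) \<Rightarrow> (nat \<Rightarrow> int) \<Rightarrow> 'a set" where
  "roots Q \<epsilon> = (\<lambda>t. \<theta> ^ t) ` exponents Q \<epsilon>"

lemma exponents_bounds: "t \<in> exponents Q \<epsilon> \<Longrightarrow> 0 < t \<and> t < n"
  by (auto simp: exponents_def M_eps_def dest: M_set_bounds)

lemma exponents_Int_M_set:
  assumes "d \<in> proper_divisors n"
  shows "exponents Q \<epsilon> \<inter> M_set n d = M_eps n d (Q d) (\<epsilon> d)"
  using assms by (auto simp: exponents_def M_eps_def dest: M_set_unique)

lemma roots_subset: "roots Q \<epsilon> \<subseteq> unity_roots"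
  unfolding roots_def unity_roots_eq using exponents_bounds by blast

lemma theta_power_in_roots_iff:
  assumes "t < n"
  shows "\<theta> ^ t \<in> roots Q \<epsilon> \<longleftrightarrow> t \<in> exponents Q \<epsilon>"
  using assms exponents_bounds theta_power_eq_iff by (auto simp: roots_def)

lemma QR_generator_eq: "QR_gen Q \<epsilon> = poly_with_roots (roots Q \<epsilon>)"
proof -
  have "QR_gen Q \<epsilon> = (\<Prod>d\<in>proper_divisors n. F_poly \<theta> n d (Q d) (\<epsilon> d))"
    unfolding QR_generator_def Union_A_set[symmetric]
    by (intro prod.UNION_disjoint[symmetric]) (auto simp: finite_A_set A_set_disjoint)
  also have "\<dots> = (\<Prod>t\<in>exponents Q \<epsilon>. [:- (\<theta> ^ t), 1:])"
    unfolding F_poly_def exponents_def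
    by (intro prod.UNION_disjoint[symmetric])
       (simp_all add: finite_proper_divisors finite_M_eps, auto simp: M_eps_def dest: M_set_unique)
  also have "\<dots> = poly_with_roots (roots Q \<epsilon>)"
    unfolding poly_with_roots_def roots_def
    by (subst prod.reindex)
       (auto intro: inj_on_subset[OF inj_on_theta_power] dest: exponents_bounds)
  finally show ?thesis .
qed

lemma cyclic_code_roots_roots: "cyclic_code_roots n \<theta> (\<kappa> (QR_gen Q \<epsilon>)) (roots Q \<epsilon>)"
  using subring_base in_polys_over_base[of "QR_gen Q \<epsilon>"] roots_subset
  by (intro cyclic_code_roots.intro cyclic_code_roots_axioms.intro unity_root_axioms)
     (auto simp: QR_generator_eq)

lemma ex_QR_code_iff:
  "(\<exists>K C. QR_code \<kappa> \<theta> p g n K C \<and> R K C) \<longleftrightarrow>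
    (\<exists>Q \<epsilon>. QR_choice p g n Q \<epsilon> \<and> R (\<kappa> (QR_gen Q \<epsilon>)) (code Q \<epsilon>))"
  by (auto simp: QR_code_def code_def)

lemma inverse_in_roots_iff:
  assumes choice: "QR_choice p g n Q \<epsilon>" and "d \<in> proper_divisors n" "t \<in> M_eps n d (Q d) (\<epsilon> d)"
  shows "inverse (\<theta> ^ t) \<in> roots Q \<epsilon> \<longleftrightarrow> Jacobi (- 1) (Q d) = 1"
proof -
  have Q_in: "Q d \<in> M_star n d" and sign: "\<epsilon> d \<in> {1, -1}"
    using choice \<open>d \<in> proper_divisors n\<close> by (simp_all add: QR_choice_iff)
  have t_in: "t \<in> M_set n d" "Jacobi (int t) (Q d) = \<epsilon> d"
    using assms(3) by (simp_all add: M_eps_def)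
  have "\<theta> ^ t * \<theta> ^ (n - t) = 1"
    using M_set_bounds[OF t_in(1)] prim by (simp add: prim_root_unity_def flip: power_add)
  then have "inverse (\<theta> ^ t) = \<theta> ^ (n - t)" by (rule inverse_unique)
  then have "inverse (\<theta> ^ t) \<in> roots Q \<epsilon> \<longleftrightarrow> n - t \<in> exponents Q \<epsilon>"
    using theta_power_in_roots_iff M_set_bounds[OF t_in(1)] by simp
  also have "\<dots> \<longleftrightarrow> Jacobi (int (n - t)) (Q d) = \<epsilon> d"
    using exponents_Int_M_set[OF \<open>d \<in> proper_divisors n\<close>, of Q \<epsilon>] minus_in_M_set[OF t_in(1)]
    by (auto simp: M_eps_def)
  also have "\<dots> \<longleftrightarrow> Jacobi (- 1) (Q d) = 1"
    using Jacobi_diff[OF M_star_odd M_star_dvd] \<open>d \<in> proper_divisors n\<close> Q_in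
      M_set_bounds[OF t_in(1)] t_in(2) sign by auto
  finally show ?thesis .
qed

lemma
  assumes choice: "QR_choice p g n Q \<epsilon>"
  shows roots_closed_inverse_iff:
      "(\<forall>z\<in>roots Q \<epsilon>. inverse z \<in> roots Q \<epsilon>) \<longleftrightarrow>
        (\<forall>d\<in>proper_divisors n. Jacobi (- 1) (Q d) = 1)"
    and roots_disjoint_inverse_iff:
      "(\<forall>z\<in>roots Q \<epsilon>. inverse z \<notin> roots Q \<epsilon>) \<longleftrightarrow>
        (\<forall>d\<in>proper_divisors n. Jacobi (- 1) (Q d) = - 1)"
proof -
  have ball_roots: "(\<forall>z\<in>roots Q \<epsilon>. R z) \<longleftrightarrow>
      (\<forall>d\<in>proper_divisors n. \<forall>t\<in>M_eps n d (Q d) (\<epsilon> d). R (\<theta> ^ t))" for R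
    by (auto simp: roots_def exponents_def)
  have choice_at: "Q d \<in> M_star n d" "\<epsilon> d \<in> {1, -1}" if "d \<in> proper_divisors n" for d
    using choice that by (simp_all add: QR_choice_iff)
  have nonempty: "M_eps n d (Q d) (\<epsilon> d) \<noteq> {}" if "d \<in> proper_divisors n" for d
    using M_eps_nonempty[OF that choice_at[OF that]] .
  have sign: "Jacobi (- 1) (Q d) = - 1 \<longleftrightarrow> Jacobi (- 1) (Q d) \<noteq> 1"
    if "d \<in> proper_divisors n" for d
    using Jacobi_minus_one_cases M_star_odd[OF that choice_at(1)[OF that]]
    by fastforce
  show "(\<forall>z\<in>roots Q \<epsilon>. inverse z \<in> roots Q \<epsilon>) \<longleftrightarrow>
        (\<forall>d\<in>proper_divisors n. Jacobi (- 1) (Q d) = 1)"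
    unfolding ball_roots using inverse_in_roots_iff[OF choice] nonempty by blast
  show "(\<forall>z\<in>roots Q \<epsilon>. inverse z \<notin> roots Q \<epsilon>) \<longleftrightarrow>
        (\<forall>d\<in>proper_divisors n. Jacobi (- 1) (Q d) = - 1)"
    unfolding ball_roots using inverse_in_roots_iff[OF choice] nonempty sign by blast
qed

lemma ex_LCD_QR_code_iff:
  "(\<exists>K C. QR_code \<kappa> \<theta> p g n K C \<and> LCD_code K n C) \<longleftrightarrow>
    (\<forall>i\<in>{1..g}. Legendre (- 1) (int (p i)) = 1)"
proof -
  have "LCD_code (\<kappa> (QR_gen Q \<epsilon>)) n (code Q \<epsilon>) \<longleftrightarrow>
      (\<forall>d\<in>proper_divisors n. Jacobi (- 1) (Q d) = 1)"
    if "QR_choice p g n Q \<epsilon>" for Q \<epsilon>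
    using cyclic_code_roots.LCD_code_iff[OF cyclic_code_roots_roots, of Q \<epsilon>]
      roots_closed_inverse_iff[OF that] by (simp add: code_def QR_generator_eq)
  then show ?thesis unfolding ex_QR_code_iff ex_QR_choice_Jacobi_minus_one_iff[symmetric] by blast
qed

lemma ex_self_orthogonal_QR_code_iff:
  "(\<exists>K C. QR_code \<kappa> \<theta> p g n K C \<and> self_orthogonal K n C) \<longleftrightarrow>
    (\<forall>i\<in>{1..g}. Legendre (- 1) (int (p i)) = - 1)"
proof -
  have "self_orthogonal (\<kappa> (QR_gen Q \<epsilon>)) n (code Q \<epsilon>) \<longleftrightarrow>
      (\<forall>d\<in>proper_divisors n. Jacobi (- 1) (Q d) = - 1)"
    if "QR_choice p g n Q \<epsilon>" for Q \<epsilon>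
    using cyclic_code_roots.self_orthogonal_iff[OF cyclic_code_roots_roots, of Q \<epsilon>]
      roots_disjoint_inverse_iff[OF that] by (simp add: code_def QR_generator_eq)
  then show ?thesis unfolding ex_QR_code_iff ex_QR_choice_Jacobi_minus_one_iff[symmetric] by blast
qed

lemma code_eq_imp_choice_eq:
  assumes "QR_choice p g n Q \<epsilon>" "QR_choice p g n Q' \<epsilon>'" "code Q \<epsilon> = code Q' \<epsilon>'"
    "d \<in> proper_divisors n"
  shows "Q d = Q' d \<and> \<epsilon> d = \<epsilon>' d"
proof -
  have zeros: "{x \<in> unity_roots. \<forall>c\<in>code Q \<epsilon>. poly c x = 0} = roots Q \<epsilon>" for Q \<epsilon>
    using cyclic_code_roots.common_zeros_code[OF cyclic_code_roots_roots, of Q \<epsilon>]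
    by (simp add: code_def QR_generator_eq)
  have "roots Q \<epsilon> = roots Q' \<epsilon>'" using zeros[of Q \<epsilon>] zeros[of Q' \<epsilon>'] assms(3) by simp
  then have "t \<in> exponents Q \<epsilon> \<longleftrightarrow> t \<in> exponents Q' \<epsilon>'" if "t < n" for t
    using theta_power_in_roots_iff[OF that] by metis
  then have "exponents Q \<epsilon> = exponents Q' \<epsilon>'" using exponents_bounds by blast
  then have "M_eps n d (Q d) (\<epsilon> d) = M_eps n d (Q' d) (\<epsilon>' d)"
    using exponents_Int_M_set[OF assms(4)] by metis
  then show ?thesis
    using M_eps_eq_iff[OF assms(4)] assms(1,2,4) by (simp add: QR_choice_iff)
qed

lemma code_cong:
  assumes "\<And>d. d \<in> proper_divisors n \<Longrightarrow> Q d = Q' d \<and> \<epsilon> d = \<epsilon>' d"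
  shows "code Q \<epsilon> = code Q' \<epsilon>'"
  using assms   by (simp add: code_def QR_generator_eq roots_def exponents_def)

lemma bij_betw_choices_QR_codes:
  "bij_betw (\<lambda>\<phi>. code (fst \<circ> \<phi>) (snd \<circ> \<phi>))
     (\<Pi>\<^sub>E d\<in>proper_divisors n. M_star n d \<times> {1, -1}) {C. \<exists>K. QR_code \<kappa> \<theta> p g n K C}"
proof (rule bij_betw_imageI)
  let ?choices = "\<Pi>\<^sub>E d\<in>proper_divisors n. M_star n d \<times> {1, -1 :: int}"
  have choice: "QR_choice p g n (fst \<circ> \<phi>) (snd \<circ> \<phi>)" if "\<phi> \<in> ?choices" for \<phi>
    using PiE_mem[OF that] by (simp add: QR_choice_iff mem_Times_iff)
  show "inj_on (\<lambda>\<phi>. code (fst \<circ> \<phi>) (snd \<circ> \<phi>)) ?choices"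
  proof (rule inj_onI)
    fix \<phi> \<psi> assume mem: "\<phi> \<in> ?choices" "\<psi> \<in> ?choices"
      and eq: "code (fst \<circ> \<phi>) (snd \<circ> \<phi>) = code (fst \<circ> \<psi>) (snd \<circ> \<psi>)"
    show "\<phi> = \<psi>"
      using code_eq_imp_choice_eq[OF choice[OF mem(1)] choice[OF mem(2)] eq]
      by (intro PiE_ext[OF mem]) (simp add: prod_eq_iff)
  qed
  show "(\<lambda>\<phi>. code (fst \<circ> \<phi>) (snd \<circ> \<phi>)) ` ?choices = {C. \<exists>K. QR_code \<kappa> \<theta> p g n K C}"
  proof (intro equalityI subsetI)
    fix C assume "C \<in> {C. \<exists>K. QR_code \<kappa> \<theta> p g n K C}"
    then obtain Q \<epsilon> where choice_Q: "QR_choice p g n Q \<epsilon>" "C = code Q \<epsilon>"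
      by (auto simp: QR_code_def code_def)
    let ?\<phi> = "\<lambda>d\<in>proper_divisors n. (Q d, \<epsilon> d)"
    have "?\<phi> \<in> ?choices" using choice_Q(1) unfolding QR_choice_iff by auto
    moreover have "C = code (fst \<circ> ?\<phi>) (snd \<circ> ?\<phi>)" unfolding choice_Q(2) by (rule code_cong) simp
    ultimately show "C \<in> (\<lambda>\<phi>. code (fst \<circ> \<phi>) (snd \<circ> \<phi>)) ` ?choices" by blast
  qed (use choice in \<open>auto simp: QR_code_def code_def\<close>)
qed

lemma card_QR_codes:
  "card {C. \<exists>K. QR_code \<kappa> \<theta> p g n K C} = (\<Prod>r<g. (2 * (2 ^ (g - r) - 1)) ^ (g choose r))"
proof -
  have "card {C. \<exists>K. QR_code \<kappa> \<theta> p g n K C} =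
      card (\<Pi>\<^sub>E d\<in>proper_divisors n. M_star n d \<times> {1, -1 :: int})"
    using bij_betw_same_card[OF bij_betw_choices_QR_codes] by simp
  also have "\<dots> = (\<Prod>d\<in>proper_divisors n. 2 * card (M_star n d))"
    using finite_proper_divisors by (simp add: card_PiE card_cartesian_product flip: mult_2)
  also have "\<dots> = (\<Prod>r<g. \<Prod>d\<in>A_set p g r. 2 * card (M_star n d))"
    unfolding Union_A_set[symmetric]
    by (intro prod.UNION_disjoint) (auto simp: finite_A_set A_set_disjoint)
  also have "\<dots> = (\<Prod>r<g. (2 * (2 ^ (g - r) - 1)) ^ (g choose r))"
    by (simp add: card_M_star card_A_set)
  finally show ?thesis .
qed

end

subsection \<open>Base fields\<close>

lemma coefficient_subring_Fq:
  assumes "prime CHAR('a::field)" "q = CHAR('a) ^ k"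
  shows "coefficient_subring (Fq q :: 'a set)"
proof
  fix x y :: 'a assume in_Fq: "x \<in> Fq q" "y \<in> Fq q"
  have "(x - y) ^ q + y ^ q = x ^ q" using freshmans_dream'[OF assms, of "x - y" y] by simp
  then show "x - y \<in> Fq q" using in_Fq by (simp add: Fq_def eq_diff_eq)
  show "x * y \<in> Fq q" using in_Fq by (simp add: Fq_def power_mult_distrib)
qed (simp add: Fq_def)

lemma base_field_rule_imp_subring:
  fixes \<kappa> :: "'a::field poly \<Rightarrow> 'a set"
  assumes "base_field_rule q \<kappa>" "prime CHAR('a)" "q = CHAR('a) ^ k"
  shows "coefficient_subring (\<kappa> f)" "f \<in> polys_over (\<kappa> f)"
proof -
  consider (whole_field) "\<kappa> f = UNIV" | (subfield) "\<kappa> f = Fq q" "f \<in> polys_over (Fq q)"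
    using assms(1) unfolding base_field_rule_def by blast
  then have "coefficient_subring (\<kappa> f) \<and> f \<in> polys_over (\<kappa> f)"
  proof cases
    case whole_field
    then show ?thesis by (simp add: coefficient_subring_def polys_over_def)
  next
    case subfield
    then show ?thesis by (simp add: coefficient_subring_Fq[OF assms(2,3)])
  qed
  then show "coefficient_subring (\<kappa> f)" "f \<in> polys_over (\<kappa> f)" by blast+
qed

lemma primepow_eq_CHAR_power:
  assumes "primepow q" "CARD('a::{field,finite}) = q ^ m"
  shows "prime CHAR('a)" "\<exists>k. q = CHAR('a) ^ k"
proof -
  show prime_CHAR: "prime CHAR('a)" by (intro prime_CHAR_semidom finite_imp_CHAR_pos) simp
  obtain r k where q_eq: "prime r" "q = r ^ k" using assms(1) by (auto simp: primepow_def)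
  have "CHAR('a) dvd r ^ (k * m)"
    using CHAR_dvd_CARD[where 'a='a] assms(2) q_eq(2) by (simp add: power_mult)
  then have "CHAR('a) = r" using prime_CHAR q_eq(1) by (metis prime_dvd_power primes_dvd_imp_eq)
  then show "\<exists>k. q = CHAR('a) ^ k" using q_eq(2) by blast
qed

theorem theorem2p2:
  fixes g n q :: nat and p :: "nat \<Rightarrow> nat"
    and \<theta> :: "'a :: {field, finite}" and \<kappa> :: "'a poly \<Rightarrow> 'a set"
  assumes "g \<ge> 1"
    and "\<And>i. i \<in> {1..g} \<Longrightarrow> prime (p i) \<and> odd (p i)"
    and "inj_on p {1..g}"
    and "n = (\<Prod>i\<in>{1..g}. p i)"
    and "primepow q"
    and "gcd n q = 1"
    and "CARD('a) = q ^ ord n q"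
    and "prim_root_unity n \<theta>"
    and "base_field_rule q \<kappa>"
  shows "card {C. \<exists>K. QR_code \<kappa> \<theta> p g n K C} =
           (\<Prod>r=0..g - 1. (2 * (2 ^ (g - r) - 1)) ^ (g choose r))
    \<and> ((\<exists>K C. QR_code \<kappa> \<theta> p g n K C \<and> LCD_code K n C)
           \<longleftrightarrow> (\<forall>i\<in>{1..g}. [p i = 1] (mod 4)))
    \<and> ((\<exists>K C. QR_code \<kappa> \<theta> p g n K C \<and> self_orthogonal K n C)
           \<longleftrightarrow> (\<forall>i\<in>{1..g}. [p i = 3] (mod 4)))"
proof -
  obtain k where char: "prime CHAR('a)" "q = CHAR('a) ^ k"
    using primepow_eq_CHAR_power[OF assms(5,7)] by blast
  interpret distinct_odd_primes p g n
    by unfold_locales (fact assms)+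
  interpret unity_root n \<theta>
    using odd_pos[OF odd_n] assms(8) by unfold_locales
  interpret QR_codes n \<theta> p g \<kappa>
    by (intro QR_codes.intro QR_codes_axioms.intro unity_root_axioms distinct_odd_primes_axioms
        base_field_rule_imp_subring[OF assms(9) char])
  have mod_4: "Legendre (- 1) (int (p i)) = 1 \<longleftrightarrow> [p i = 1] (mod 4)"
    "Legendre (- 1) (int (p i)) = - 1 \<longleftrightarrow> [p i = 3] (mod 4)" if "i \<in> {1..g}" for i
    using Legendre_minus_one_eq_iff assms(2)[OF that] by blast+
  have "{0..g - 1} = {..<g}" using assms(1) by auto
  then show ?thesis
    using card_QR_codes ex_LCD_QR_code_iff ex_self_orthogonal_QR_code_iff mod_4 by simp
qed

end
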